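(* Let $\underline R$ be a square ring and let $\underline M=(M,A)$ be an $\underline R$-CP-module. Then the $\mathbb N^*$-graded abelian group $$\mathrm{Gr}(M,A)=(M/A,\ A,\ 0,\ldots)$$ has a natural structure of graded algebra over the operad $\mathrm{OP}(\underline R)$.
   Context: A square ring $\underline R=(R_e\xrightarrow{H}R_{ee}\xrightarrow{P}R_e)$ consists of: a set $R_e$ with a group structure $+$ (not necessarily commutative) and an associative unital multiplication satisfying $r(s+t)=rs+rt$ (the law $(r+s)t=rt+st$ is not required); an abelian group $R_{ee}$; a map $R_e\times R_e\times R_{ee}\times R_e\to R_{ee}$, $(r,s,x,t)\mapsto(r,s)\cdot x\cdot t$, additive in each of its four variables and defining commuting actions on $R_{ee}$ of the multiplicative monoids $R_e\times R_e$ (on the left) and $R_e$ (on the right) (write $(r,s)\cdot x$ if $t=1$ and $x\cdot t$ if $r=s=1$); a group homomorphism $T:R_{ee}\to R_{ee}$ with $T^2=\mathrm{Id}$; a map $H:R_e\to R_{ee}$ and a group homomorphism $P:R_{ee}\to R_e$; such that for all $r,s,t\in R_e$, $x,y\in R_{ee}$: $PHP=P+P$; $P((r,r)\cdot x\cdot s)=rP(x)s$; $T=HP-\mathrm{Id}$; $PT=P$; $(P(x),r)\cdot y=(r,P(x))\cdot y=0=y\cdot P(x)$; $H(r+s)=H(r)+H(s)+(s,r)\cdot H(2)$ where $2=1+1$; $H(rs)=(r,r)\cdot H(s)+H(r)\cdot s$; $(r+s)t=rt+st+P((r,s)\cdot H(t))$; $T((r,s)\cdot x\cdot t)=(s,r)\cdot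 T(x)\cdot t$. The quotient $\overline R=R_e/\operatorname{Im}P$ is a ring and $R_{ee}$ is an $\overline R\otimes\overline R\otimes\overline R^{op}$-module. $\mathrm{OP}(\underline R)$ is the operad of abelian groups, nilpotent of class $\le2$, with $\mathrm{OP}(\underline R)_1=\overline R$, $\mathrm{OP}(\underline R)_2=R_{ee}$ (symmetric group action given by $T$), $\mathrm{OP}(\underline R)_k=0$ for $k>2$, and compositions given by the multiplication of $\overline R$ and its actions on $R_{ee}$. Concretely, a graded $\mathrm{OP}(\underline R)$-algebra structure on a graded abelian group $X=(X_1,X_2,0,\ldots)$ consists of right $\overline R$-module structures on $X_1,X_2$ and maps $X_i\times X_j\times R_{ee}\to X_{i+j}$, $(u,v,x)\mapsto[u,v]\cdot x$, additive in each variable, with $[v,u]\cdot x=[u,v]\cdot T(x)$, $([u\cdot r,v\cdot s]\cdot x)\cdot t=[u,v]\cdot((r,s)\cdot x\cdot t)$ for $r,s,t\in\overline R$, and vanishing iterated operations $[[u,v]\cdot x,w]\cdot y=0$. A (right) $\underline R$-BHP-module is a group $M$ (written additively, not necessarily commutative) with operations $M\times R_e\to M$, $(m,r)\mapsto m\cdot r$ and $M\times M\times R_{ee}\to M$, $(m,n,x)\mapsto[m,n]\cdot x$ such that: $m\cdot1=m$, $(m\cdot r)\cdot s=m\cdot(rs)$, $m\cdot(r+s)=m\cdot r+m\cdot s$; $(m+n)\cdot r=m\cdot r+n\cdot r+[m,n]\cdot H(r)$; $m\cdot P(x)=[m,m]\cdot x$; $[m,n]\cdot T(x)=[n,m]\cdot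 x$; $[m,n]\cdot x$ is additive in each of $m,n,x$; $([m\cdot r,n\cdot s]\cdot x)\cdot t=[m,n]\cdot((r,s)\cdot x\cdot t)$; $[[m,m']\cdot x,n]\cdot y=0$. An $\underline R$-CP-module is a pair $(M,A)$ where $M$ is an $\underline R$-BHP-module and $A$ is a subgroup of $M$, stable under the action of $R_e$, such that $[m,n]\cdot x=0$ whenever $m\in A$, and $[m,n]\cdot x\in A$ for all $m,n\in M$, $x\in R_{ee}$. The natural structure meant is the one induced by the operations of $M$: $(\overline m,a)\cdot\overline r=(\overline{m\cdot r},a\cdot r)$ on $M/A\oplus A$, and $\overline m\otimes\overline{m'}\otimes x\mapsto[m,m']\cdot x$ from $(M/A)\otimes(M/A)\otimes R_{ee}$ to $A$ (all other binary operations being zero for degree reasons). *)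

theory Defs
  imports "HOL-Algebra.Algebra"
begin

text \<open>
  The groups \<open>R\<^sub>e\<^sub>e\<close> (called \<open>E\<close>) and \<open>M\<close>, written additively in the mathematics, are
  \<^typ>\<open>'a monoid\<close> records as in HOL-Algebra.  So for them \<open>\<otimes>\<close> is the group addition, \<open>\<one>\<close> its
  zero and \<open>inv\<close> the negative.  \<open>R\<^sub>e\<close> is a \<^typ>\<open>'a ring\<close> record \<open>R\<close>, whose addition \<open>\<oplus>\<close> need not
  be commutative, and \<open>act r s x t\<close> stands for \<open>(r,s)\<cdot>x\<cdot>t\<close>.
\<close>

locale square_ring =
  mult_monoid: monoid R + add_group: group "add_monoid R" + ee: comm_group E
  for R :: "'r ring" (structure) and E :: "'e monoid" +
  fixes act :: "'r \<Rightarrow> 'r \<Rightarrow> 'e \<Rightarrow> 'r \<Rightarrow> 'e"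
    and T :: "'e \<Rightarrow> 'e"
    and H :: "'r \<Rightarrow> 'e"
    and P :: "'e \<Rightarrow> 'r"
  assumes distr_left: "\<lbrakk>r \<in> carrier R; s \<in> carrier R; t \<in> carrier R\<rbrakk>
      \<Longrightarrow> r \<otimes> (s \<oplus> t) = r \<otimes> s \<oplus> r \<otimes> t"
    and act_closed: "\<lbrakk>r \<in> carrier R; s \<in> carrier R; x \<in> carrier E; t \<in> carrier R\<rbrakk>
      \<Longrightarrow> act r s x t \<in> carrier E"
    and act_add1: "\<lbrakk>r \<in> carrier R; r' \<in> carrier R; s \<in> carrier R; x \<in> carrier E; t \<in> carrier R\<rbrakk>
      \<Longrightarrow> act (r \<oplus> r') s x t = act r s x t \<otimes>\<^bsub>E\<^esub> act r' s x t"
    and act_add2: "\<lbrakk>r \<in> carrier R; s \<in> carrier R; s' \<in> carrier R; x \<in> carrier E; t \<in> carrier R\<rbrakk>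
      \<Longrightarrow> act r (s \<oplus> s') x t = act r s x t \<otimes>\<^bsub>E\<^esub> act r s' x t"
    and act_add3: "\<lbrakk>r \<in> carrier R; s \<in> carrier R; x \<in> carrier E; x' \<in> carrier E; t \<in> carrier R\<rbrakk>
      \<Longrightarrow> act r s (x \<otimes>\<^bsub>E\<^esub> x') t = act r s x t \<otimes>\<^bsub>E\<^esub> act r s x' t"
    and act_add4: "\<lbrakk>r \<in> carrier R; s \<in> carrier R; x \<in> carrier E; t \<in> carrier R; t' \<in> carrier R\<rbrakk>
      \<Longrightarrow> act r s x (t \<oplus> t') = act r s x t \<otimes>\<^bsub>E\<^esub> act r s x t'"
    and act_one: "x \<in> carrier E \<Longrightarrow> act \<one> \<one> x \<one> = x"
    and act_act: "\<lbrakk>r \<in> carrier R; r' \<in> carrier R; s \<in> carrier R; s' \<in> carrier R;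
        x \<in> carrier E; t \<in> carrier R; t' \<in> carrier R\<rbrakk>
      \<Longrightarrow> act r s (act r' s' x t) t' = act (r \<otimes> r') (s \<otimes> s') x (t \<otimes> t')"
    and T_hom: "T \<in> hom E E"
    and T_T: "x \<in> carrier E \<Longrightarrow> T (T x) = x"
    and H_closed: "r \<in> carrier R \<Longrightarrow> H r \<in> carrier E"
    and P_hom: "P \<in> hom E (add_monoid R)"
    and PHP: "x \<in> carrier E \<Longrightarrow> P (H (P x)) = P x \<oplus> P x"
    and P_act: "\<lbrakk>r \<in> carrier R; s \<in> carrier R; x \<in> carrier E\<rbrakk>
      \<Longrightarrow> P (act r r x s) = r \<otimes> P x \<otimes> s"
    and T_HP: "x \<in> carrier E \<Longrightarrow> T x = H (P x) \<otimes>\<^bsub>E\<^esub> inv\<^bsub>E\<^esub> x"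
    and P_T: "x \<in> carrier E \<Longrightarrow> P (T x) = P x"
    and act_P1: "\<lbrakk>r \<in> carrier R; x \<in> carrier E; y \<in> carrier E\<rbrakk>
      \<Longrightarrow> act (P x) r y \<one> = \<one>\<^bsub>E\<^esub>"
    and act_P2: "\<lbrakk>r \<in> carrier R; x \<in> carrier E; y \<in> carrier E\<rbrakk>
      \<Longrightarrow> act r (P x) y \<one> = \<one>\<^bsub>E\<^esub>"
    and act_P4: "\<lbrakk>x \<in> carrier E; y \<in> carrier E\<rbrakk> \<Longrightarrow> act \<one> \<one> y (P x) = \<one>\<^bsub>E\<^esub>"
    and H_add: "\<lbrakk>r \<in> carrier R; s \<in> carrier R\<rbrakk>
      \<Longrightarrow> H (r \<oplus> s) = H r \<otimes>\<^bsub>E\<^esub> H s \<otimes>\<^bsub>E\<^esub> act s r (H (\<one> \<oplus> \<one>)) \<one>"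
    and H_mult: "\<lbrakk>r \<in> carrier R; s \<in> carrier R\<rbrakk>
      \<Longrightarrow> H (r \<otimes> s) = act r r (H s) \<one> \<otimes>\<^bsub>E\<^esub> act \<one> \<one> (H r) s"
    and distr_right: "\<lbrakk>r \<in> carrier R; s \<in> carrier R; t \<in> carrier R\<rbrakk>
      \<Longrightarrow> (r \<oplus> s) \<otimes> t = r \<otimes> t \<oplus> s \<otimes> t \<oplus> P (act r s (H t) \<one>)"
    and T_act: "\<lbrakk>r \<in> carrier R; s \<in> carrier R; x \<in> carrier E; t \<in> carrier R\<rbrakk>
      \<Longrightarrow> T (act r s x t) = act s r (T x) t"

text \<open>\<open>sm m r\<close> stands for \<open>m\<cdot>r\<close> and \<open>br m n x\<close> for \<open>[m,n]\<cdot>x\<close>.\<close>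

locale BHP_module = square_ring R E act T H P + M: group M
  for R :: "'r ring" (structure) and E :: "'e monoid" and act T H P and M :: "'m monoid" +
  fixes sm :: "'m \<Rightarrow> 'r \<Rightarrow> 'm"
    and br :: "'m \<Rightarrow> 'm \<Rightarrow> 'e \<Rightarrow> 'm"
  assumes sm_closed: "\<lbrakk>m \<in> carrier M; r \<in> carrier R\<rbrakk> \<Longrightarrow> sm m r \<in> carrier M"
    and br_closed: "\<lbrakk>m \<in> carrier M; n \<in> carrier M; x \<in> carrier E\<rbrakk> \<Longrightarrow> br m n x \<in> carrier M"
    and sm_one: "m \<in> carrier M \<Longrightarrow> sm m \<one> = m"
    and sm_sm: "\<lbrakk>m \<in> carrier M; r \<in> carrier R; s \<in> carrier R\<rbrakk> \<Longrightarrow> sm (sm m r) s = sm m (r \<otimes> s)"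
    and sm_add_right: "\<lbrakk>m \<in> carrier M; r \<in> carrier R; s \<in> carrier R\<rbrakk>
      \<Longrightarrow> sm m (r \<oplus> s) = sm m r \<otimes>\<^bsub>M\<^esub> sm m s"
    and sm_add_left: "\<lbrakk>m \<in> carrier M; n \<in> carrier M; r \<in> carrier R\<rbrakk>
      \<Longrightarrow> sm (m \<otimes>\<^bsub>M\<^esub> n) r = sm m r \<otimes>\<^bsub>M\<^esub> sm n r \<otimes>\<^bsub>M\<^esub> br m n (H r)"
    and sm_P: "\<lbrakk>m \<in> carrier M; x \<in> carrier E\<rbrakk> \<Longrightarrow> sm m (P x) = br m m x"
    and br_T: "\<lbrakk>m \<in> carrier M; n \<in> carrier M; x \<in> carrier E\<rbrakk> \<Longrightarrow> br m n (T x) = br n m x"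
    and br_add1: "\<lbrakk>m \<in> carrier M; m' \<in> carrier M; n \<in> carrier M; x \<in> carrier E\<rbrakk>
      \<Longrightarrow> br (m \<otimes>\<^bsub>M\<^esub> m') n x = br m n x \<otimes>\<^bsub>M\<^esub> br m' n x"
    and br_add2: "\<lbrakk>m \<in> carrier M; n \<in> carrier M; n' \<in> carrier M; x \<in> carrier E\<rbrakk>
      \<Longrightarrow> br m (n \<otimes>\<^bsub>M\<^esub> n') x = br m n x \<otimes>\<^bsub>M\<^esub> br m n' x"
    and br_add3: "\<lbrakk>m \<in> carrier M; n \<in> carrier M; x \<in> carrier E; x' \<in> carrier E\<rbrakk>
      \<Longrightarrow> br m n (x \<otimes>\<^bsub>E\<^esub> x') = br m n x \<otimes>\<^bsub>M\<^esub> br m n x'"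
    and br_sm: "\<lbrakk>m \<in> carrier M; n \<in> carrier M; x \<in> carrier E;
        r \<in> carrier R; s \<in> carrier R; t \<in> carrier R\<rbrakk>
      \<Longrightarrow> sm (br (sm m r) (sm n s) x) t = br m n (act r s x t)"
    and br_br: "\<lbrakk>m \<in> carrier M; m' \<in> carrier M; n \<in> carrier M; x \<in> carrier E; y \<in> carrier E\<rbrakk>
      \<Longrightarrow> br (br m m' x) n y = \<one>\<^bsub>M\<^esub>"

locale CP_module = BHP_module R E act T H P M sm br
  for R :: "'r ring" (structure) and E :: "'e monoid" and act T H P
    and M :: "'m monoid" and sm br +
  fixes A :: "'m set"
  assumes A_subgroup: "subgroup A M"
    and A_sm: "\<lbrakk>a \<in> A; r \<in> carrier R\<rbrakk> \<Longrightarrow> sm a r \<in> A"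
    and A_br: "\<lbrakk>a \<in> A; n \<in> carrier M; x \<in> carrier E\<rbrakk> \<Longrightarrow> br a n x = \<one>\<^bsub>M\<^esub>"
    and br_in_A: "\<lbrakk>m \<in> carrier M; n \<in> carrier M; x \<in> carrier E\<rbrakk> \<Longrightarrow> br m n x \<in> A"

text \<open>
  An operad of abelian groups concentrated in arities 1 and 2 (hence nilpotent of class at most 2)
  is a ring (arity 1), an abelian group with an involution (arity 2), and the composition
  \<open>op_comp r s x t\<close>, meaning \<open>(r,s)\<cdot>x\<cdot>t\<close>: the unary operations \<open>r\<close> and \<open>s\<close> are applied to the two
  inputs of \<open>x\<close> and \<open>t\<close> to its output.  All other compositions land in a zero group.
\<close>

record ('a, 'b) class2_operad =
  op1 :: "'a ring"
  op2 :: "'b monoid"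
  op_swap :: "'b \<Rightarrow> 'b"
  op_comp :: "'a \<Rightarrow> 'a \<Rightarrow> 'b \<Rightarrow> 'a \<Rightarrow> 'b"

locale class2_operad = op1: ring "op1 Q" + op2: comm_group "op2 Q"
  for Q :: "('a, 'b) class2_operad" +
  assumes op_swap_hom: "op_swap Q \<in> hom (op2 Q) (op2 Q)"
    and op_swap_swap: "x \<in> carrier (op2 Q) \<Longrightarrow> op_swap Q (op_swap Q x) = x"
    and op_comp_closed: "\<lbrakk>r \<in> carrier (op1 Q); s \<in> carrier (op1 Q); x \<in> carrier (op2 Q);
        t \<in> carrier (op1 Q)\<rbrakk> \<Longrightarrow> op_comp Q r s x t \<in> carrier (op2 Q)"
    and op_comp_add1: "\<lbrakk>r \<in> carrier (op1 Q); r' \<in> carrier (op1 Q); s \<in> carrier (op1 Q);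
        x \<in> carrier (op2 Q); t \<in> carrier (op1 Q)\<rbrakk>
      \<Longrightarrow> op_comp Q (r \<oplus>\<^bsub>op1 Q\<^esub> r') s x t = op_comp Q r s x t \<otimes>\<^bsub>op2 Q\<^esub> op_comp Q r' s x t"
    and op_comp_add2: "\<lbrakk>r \<in> carrier (op1 Q); s \<in> carrier (op1 Q); s' \<in> carrier (op1 Q);
        x \<in> carrier (op2 Q); t \<in> carrier (op1 Q)\<rbrakk>
      \<Longrightarrow> op_comp Q r (s \<oplus>\<^bsub>op1 Q\<^esub> s') x t = op_comp Q r s x t \<otimes>\<^bsub>op2 Q\<^esub> op_comp Q r s' x t"
    and op_comp_add3: "\<lbrakk>r \<in> carrier (op1 Q); s \<in> carrier (op1 Q); x \<in> carrier (op2 Q);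
        x' \<in> carrier (op2 Q); t \<in> carrier (op1 Q)\<rbrakk>
      \<Longrightarrow> op_comp Q r s (x \<otimes>\<^bsub>op2 Q\<^esub> x') t = op_comp Q r s x t \<otimes>\<^bsub>op2 Q\<^esub> op_comp Q r s x' t"
    and op_comp_add4: "\<lbrakk>r \<in> carrier (op1 Q); s \<in> carrier (op1 Q); x \<in> carrier (op2 Q);
        t \<in> carrier (op1 Q); t' \<in> carrier (op1 Q)\<rbrakk>
      \<Longrightarrow> op_comp Q r s x (t \<oplus>\<^bsub>op1 Q\<^esub> t') = op_comp Q r s x t \<otimes>\<^bsub>op2 Q\<^esub> op_comp Q r s x t'"
    and op_comp_one: "x \<in> carrier (op2 Q)
      \<Longrightarrow> op_comp Q \<one>\<^bsub>op1 Q\<^esub> \<one>\<^bsub>op1 Q\<^esub> x \<one>\<^bsub>op1 Q\<^esub> = x"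
    and op_comp_comp: "\<lbrakk>r \<in> carrier (op1 Q); r' \<in> carrier (op1 Q); s \<in> carrier (op1 Q);
        s' \<in> carrier (op1 Q); x \<in> carrier (op2 Q); t \<in> carrier (op1 Q); t' \<in> carrier (op1 Q)\<rbrakk>
      \<Longrightarrow> op_comp Q r s (op_comp Q r' s' x t) t'
        = op_comp Q (r \<otimes>\<^bsub>op1 Q\<^esub> r') (s \<otimes>\<^bsub>op1 Q\<^esub> s') x (t \<otimes>\<^bsub>op1 Q\<^esub> t')"
    and op_swap_comp: "\<lbrakk>r \<in> carrier (op1 Q); s \<in> carrier (op1 Q); x \<in> carrier (op2 Q);
        t \<in> carrier (op1 Q)\<rbrakk>
      \<Longrightarrow> op_swap Q (op_comp Q r s x t) = op_comp Q s r (op_swap Q x) t"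

text \<open>
  In the quotient below \<^const>\<open>FactRing\<close> is used as a bare construction of coset addition and
  multiplication, since \<open>R\<close> itself is not a ring.  Elements of the quotient act on \<open>E\<close> through
  arbitrary representatives, so that the set under \<^const>\<open>the_elem\<close> is a singleton.
\<close>

definition OP :: "'r ring \<Rightarrow> 'e monoid \<Rightarrow> ('r \<Rightarrow> 'r \<Rightarrow> 'e \<Rightarrow> 'r \<Rightarrow> 'e) \<Rightarrow> ('e \<Rightarrow> 'e)
    \<Rightarrow> ('e \<Rightarrow> 'r) \<Rightarrow> ('r set, 'e) class2_operad"
  where "OP R E act T P =
    \<lparr>op1 = R Quot (P ` carrier E),
     op2 = E,
     op_swap = T,
     op_comp = (\<lambda>K L x N. the_elem {act r s x t | r s t. r \<in> K \<and> s \<in> L \<and> t \<in> N})\<rparr>"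

locale right_module = scalars: ring S + module_group: comm_group V
  for S :: "'a ring" and V :: "'x monoid" +
  fixes sc :: "'x \<Rightarrow> 'a \<Rightarrow> 'x"
  assumes sc_closed: "\<lbrakk>u \<in> carrier V; r \<in> carrier S\<rbrakk> \<Longrightarrow> sc u r \<in> carrier V"
    and sc_add_left: "\<lbrakk>u \<in> carrier V; v \<in> carrier V; r \<in> carrier S\<rbrakk>
      \<Longrightarrow> sc (u \<otimes>\<^bsub>V\<^esub> v) r = sc u r \<otimes>\<^bsub>V\<^esub> sc v r"
    and sc_add_right: "\<lbrakk>u \<in> carrier V; r \<in> carrier S; s \<in> carrier S\<rbrakk>
      \<Longrightarrow> sc u (r \<oplus>\<^bsub>S\<^esub> s) = sc u r \<otimes>\<^bsub>V\<^esub> sc u s"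
    and sc_one: "u \<in> carrier V \<Longrightarrow> sc u \<one>\<^bsub>S\<^esub> = u"
    and sc_mult: "\<lbrakk>u \<in> carrier V; r \<in> carrier S; s \<in> carrier S\<rbrakk>
      \<Longrightarrow> sc (sc u r) s = sc u (r \<otimes>\<^bsub>S\<^esub> s)"

text \<open>
  A graded abelian group is the family of its components \<open>V i\<close>, \<open>i \<ge> 1\<close>; the value \<open>V 0\<close> is
  irrelevant.  \<open>sc i u r\<close> is \<open>u\<cdot>r\<close> for \<open>u\<close> in \<open>V i\<close>, and \<open>brk i j u v x\<close> is \<open>[u,v]\<cdot>x\<close> for \<open>u\<close> in
  \<open>V i\<close> and \<open>v\<close> in \<open>V j\<close>.
\<close>

locale graded_algebra = class2_operad Q
  for Q :: "('a, 'b) class2_operad" +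
  fixes V :: "nat \<Rightarrow> 'x monoid"
    and sc :: "nat \<Rightarrow> 'x \<Rightarrow> 'a \<Rightarrow> 'x"
    and brk :: "nat \<Rightarrow> nat \<Rightarrow> 'x \<Rightarrow> 'x \<Rightarrow> 'b \<Rightarrow> 'x"
  assumes right_modules: "i \<ge> 1 \<Longrightarrow> right_module (op1 Q) (V i) (sc i)"
    and brk_closed: "\<lbrakk>i \<ge> 1; j \<ge> 1; u \<in> carrier (V i); v \<in> carrier (V j); x \<in> carrier (op2 Q)\<rbrakk>
      \<Longrightarrow> brk i j u v x \<in> carrier (V (i + j))"
    and brk_add1: "\<lbrakk>i \<ge> 1; j \<ge> 1; u \<in> carrier (V i); u' \<in> carrier (V i); v \<in> carrier (V j);
        x \<in> carrier (op2 Q)\<rbrakk>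
      \<Longrightarrow> brk i j (u \<otimes>\<^bsub>V i\<^esub> u') v x = brk i j u v x \<otimes>\<^bsub>V (i + j)\<^esub> brk i j u' v x"
    and brk_add2: "\<lbrakk>i \<ge> 1; j \<ge> 1; u \<in> carrier (V i); v \<in> carrier (V j); v' \<in> carrier (V j);
        x \<in> carrier (op2 Q)\<rbrakk>
      \<Longrightarrow> brk i j u (v \<otimes>\<^bsub>V j\<^esub> v') x = brk i j u v x \<otimes>\<^bsub>V (i + j)\<^esub> brk i j u v' x"
    and brk_add3: "\<lbrakk>i \<ge> 1; j \<ge> 1; u \<in> carrier (V i); v \<in> carrier (V j);
        x \<in> carrier (op2 Q); x' \<in> carrier (op2 Q)\<rbrakk>
      \<Longrightarrow> brk i j u v (x \<otimes>\<^bsub>op2 Q\<^esub> x') = brk i j u v x \<otimes>\<^bsub>V (i + j)\<^esub> brk i j u v x'"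
    and brk_swap: "\<lbrakk>i \<ge> 1; j \<ge> 1; u \<in> carrier (V i); v \<in> carrier (V j); x \<in> carrier (op2 Q)\<rbrakk>
      \<Longrightarrow> brk j i v u x = brk i j u v (op_swap Q x)"
    and brk_comp: "\<lbrakk>i \<ge> 1; j \<ge> 1; u \<in> carrier (V i); v \<in> carrier (V j); x \<in> carrier (op2 Q);
        r \<in> carrier (op1 Q); s \<in> carrier (op1 Q); t \<in> carrier (op1 Q)\<rbrakk>
      \<Longrightarrow> sc (i + j) (brk i j (sc i u r) (sc j v s) x) t = brk i j u v (op_comp Q r s x t)"
    and brk_brk: "\<lbrakk>i \<ge> 1; j \<ge> 1; k \<ge> 1; u \<in> carrier (V i); v \<in> carrier (V j);
        w \<in> carrier (V k); x \<in> carrier (op2 Q); y \<in> carrier (op2 Q)\<rbrakk>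
      \<Longrightarrow> brk (i + j) k (brk i j u v x) w y = \<one>\<^bsub>V (i + j + k)\<^esub>"

text \<open>
  The components of \<open>(M/A, A, 0, \<dots>)\<close> live in a common type as the homogeneous parts of the direct
  sum of \<open>M/A\<close> and \<open>A\<close>.  The pair \<open>(A, \<one>\<^bsub>M\<^esub>)\<close> is the zero element; the two embeddings send the coset
  of \<open>m\<close> to \<open>(A #>\<^bsub>M\<^esub> m, \<one>\<^bsub>M\<^esub>)\<close> in degree 1 and \<open>a\<close> to \<open>(A, a)\<close> in degree 2.
\<close>

definition Gr :: "'m monoid \<Rightarrow> 'm set \<Rightarrow> nat \<Rightarrow> ('m set \<times> 'm) monoid"
  where "Gr M A i =
    (if i = 1 then (M Mod A) \<times>\<times> singleton_group \<one>\<^bsub>M\<^esub>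
     else if i = 2 then singleton_group A \<times>\<times> M\<lparr>carrier := A\<rparr>
     else singleton_group A \<times>\<times> singleton_group \<one>\<^bsub>M\<^esub>)"

end

theory Submission
  imports Defs
begin

text \<open>
  Expanding \<open>(x + y) \<cdot> 2\<close> with either distributive law gives \<open>x + y + x + y = x + x + y + y + c\<close>,
  where the error term \<open>c\<close> is \<open>P((x,y)\<cdot>H(2))\<close> in \<open>R\<^sub>e\<close> and \<open>[x,y]\<cdot>H(2)\<close> in \<open>M\<close>.  As \<open>c\<close> vanishes
  when \<open>x\<close> lies in \<open>Im P\<close>, respectively in \<open>A\<close>, these subgroups are central with abelian quotients.
  The remaining axioms descend to representatives, because every error term lies in the
  subgroup divided out and every bracket kills \<open>A\<close>.
\<close>

section \<open>Central subgroups with abelian quotient\<close>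

lemma (in group) central_subgroup_quotient:
  assumes N: "subgroup N G"
    and c: "\<And>x y. \<lbrakk>x \<in> carrier G; y \<in> carrier G\<rbrakk> \<Longrightarrow> x \<otimes> y \<otimes> x \<otimes> y = x \<otimes> x \<otimes> y \<otimes> y \<otimes> c x y"
    and c_in: "\<And>x y. \<lbrakk>x \<in> carrier G; y \<in> carrier G\<rbrakk> \<Longrightarrow> c x y \<in> N"
    and c_one: "\<And>n y. \<lbrakk>n \<in> N; y \<in> carrier G\<rbrakk> \<Longrightarrow> c n y = \<one>"
  shows "\<And>n x. \<lbrakk>n \<in> N; x \<in> carrier G\<rbrakk> \<Longrightarrow> x \<otimes> n = n \<otimes> x"
    and "N \<lhd> G" and "comm_group (G Mod N)"
proof -
  have N_closed: "n \<in> carrier G" if "n \<in> N" for n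
    using N that by (rule subgroup.mem_carrier)
  have swap: "y \<otimes> x \<otimes> y = x \<otimes> y \<otimes> y \<otimes> c x y" if "x \<in> carrier G" "y \<in> carrier G" for x y
  proof -
    have "x \<otimes> (y \<otimes> x \<otimes> y) = x \<otimes> (x \<otimes> y \<otimes> y \<otimes> c x y)"
      using c[OF that] that N_closed[OF c_in[OF that]] by (simp add: m_assoc)
    then show ?thesis
      using that N_closed[OF c_in[OF that]] by (subst (asm) l_cancel) auto
  qed
  \<comment> \<open>For \<open>n\<close> in \<open>N\<close> the error term is trivial, so
    \<open>swap\<close> reads \<open>x n x = n x x\<close>, and cancelling the last \<open>x\<close>
    leaves commutation.\<close>
  show central: "x \<otimes> n = n \<otimes> x" if "n \<in> N" "x \<in> carrier G" for n x
  proof -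
    have "x \<otimes> n \<otimes> x = n \<otimes> x \<otimes> x"
      using swap[OF N_closed[OF that(1)] that(2)] c_one[OF that] that N_closed by simp
    then show ?thesis
      using that N_closed by (subst (asm) r_cancel) auto
  qed
  \<comment> \<open>By the centrality just proved, \<open>c x y\<close> can be moved to the front in
    \<open>swap\<close>, which frees the last \<open>y\<close> for cancellation. Thus
    \<open>x y\<close> and \<open>y x\<close> differ by an element of \<open>N\<close>.\<close>
  have comm: "y \<otimes> x = c x y \<otimes> (x \<otimes> y)" if "x \<in> carrier G" "y \<in> carrier G" for x y
  proof -
    note cc = N_closed[OF c_in[OF that]]
    have "y \<otimes> x \<otimes> y = c x y \<otimes> (x \<otimes> y) \<otimes> y"
      using swap[OF that] central[OF c_in[OF that], of "x \<otimes> y \<otimes> y"] that cc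
      by (simp add: m_assoc)
    then show ?thesis
      using that cc by (subst (asm) r_cancel) auto
  qed
  show normal: "N \<lhd> G"
  proof -
    have "x \<otimes> n \<otimes> inv x = n" if "x \<in> carrier G" "n \<in> N" for x n
      using that N_closed by (simp add: central m_assoc)
    then show ?thesis
      using N by (simp add: normal_inv_iff)
  qed
  interpret normal N G by (rule normal)
  show "comm_group (G Mod N)"
  proof (rule group.group_comm_groupI[OF factorgroup_is_group])
    fix K L assume "K \<in> carrier (G Mod N)" "L \<in> carrier (G Mod N)"
    then obtain x y where xy: "x \<in> carrier G" "K = N #> x" "y \<in> carrier G" "L = N #> y"
      by (auto simp: carrier_FactGroup)
    have "c x y \<otimes> (x \<otimes> y) \<in> N #> (x \<otimes> y)"
      using xy c_in by (intro rcosI) (auto simp: N_closed)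
    then have "N #> (x \<otimes> y) = N #> (y \<otimes> x)"
      using comm[of x y] xy N by (intro repr_independence) auto
    then show "K \<otimes>\<^bsub>G Mod N\<^esub> L = L \<otimes>\<^bsub>G Mod N\<^esub> K"
      using xy by (simp add: rcos_sum)
  qed
qed

section \<open>The quotient ring of a square ring and its operad\<close>

context square_ring
begin

abbreviation (input) Im_P where "Im_P \<equiv> P ` carrier E"

lemma add_closed [simp]: "\<lbrakk>r \<in> carrier R; s \<in> carrier R\<rbrakk> \<Longrightarrow> r \<oplus> s \<in> carrier R"
  using add_group.m_closed by simp

lemma P_closed [simp]: "x \<in> carrier E \<Longrightarrow> P x \<in> carrier R"
  using hom_in_carrier[OF P_hom] by simp

lemma add_zero [simp]:
  assumes "r \<in> carrier R" shows "r \<oplus> \<zero> = r" and "\<zero> \<oplus> r = r"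
  using assms add_group.r_one[of r] add_group.l_one[of r] by simp_all

lemma P_one: "P \<one>\<^bsub>E\<^esub> = \<zero>"
  using hom_one[OF P_hom ee.is_group add_group.is_group] by simp

lemma act_zero3: "\<lbrakk>r \<in> carrier R; s \<in> carrier R; t \<in> carrier R\<rbrakk> \<Longrightarrow> act r s \<one>\<^bsub>E\<^esub> t = \<one>\<^bsub>E\<^esub>"
  using act_add3[of r s "\<one>\<^bsub>E\<^esub>" "\<one>\<^bsub>E\<^esub>" t] act_closed[of r s "\<one>\<^bsub>E\<^esub>" t] by simp

text \<open>The vanishing axioms have units in the remaining slots: \<open>t = 1\<close> for the
  first two, \<open>r = s = 1\<close> for the third. \<open>act_act\<close> performs the right
  action last, so either the inner or the outer action is already zero.\<close>

lemma act_P_eq_one: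
  assumes "r \<in> carrier R" "s \<in> carrier R" "x \<in> carrier E" "y \<in> carrier E" "t \<in> carrier R"
  shows "act (P y) s x t = \<one>\<^bsub>E\<^esub>" and "act r (P y) x t = \<one>\<^bsub>E\<^esub>" and "act r s x (P y) = \<one>\<^bsub>E\<^esub>"
proof -
  show "act (P y) s x t = \<one>\<^bsub>E\<^esub>"
    using act_act[of \<one> "P y" \<one> s x \<one> t] assms by (simp add: act_P1 act_zero3)
  show "act r (P y) x t = \<one>\<^bsub>E\<^esub>"
    using act_act[of \<one> r \<one> "P y" x \<one> t] assms by (simp add: act_P2 act_zero3)
  show "act r s x (P y) = \<one>\<^bsub>E\<^esub>"
    using act_act[of \<one> r \<one> s x \<one> "P y"] assms by (simp add: act_P4 act_closed)
qed

lemma subgroup_Im_P: "subgroup Im_P (add_monoid R)"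
proof -
  interpret group_hom E "add_monoid R" P
    by unfold_locales (rule P_hom)
  show ?thesis by (rule img_is_subgroup)
qed

lemma Im_P_normal: "Im_P \<lhd> add_monoid R"
  and Im_P_quotient_comm: "comm_group (add_monoid R Mod Im_P)"
proof -
  let ?two = "\<one> \<oplus> \<one>"
  let ?c = "\<lambda>r s. P (act r s (H ?two) \<one>)"
  have *: "r \<otimes>\<^bsub>add_monoid R\<^esub> s \<otimes>\<^bsub>add_monoid R\<^esub> r \<otimes>\<^bsub>add_monoid R\<^esub> s
      = r \<otimes>\<^bsub>add_monoid R\<^esub> r \<otimes>\<^bsub>add_monoid R\<^esub> s \<otimes>\<^bsub>add_monoid R\<^esub> s \<otimes>\<^bsub>add_monoid R\<^esub> ?c r s"
    if "r \<in> carrier (add_monoid R)" "s \<in> carrier (add_monoid R)" for r s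
  proof -
    have "(r \<oplus> s) \<otimes> ?two = r \<oplus> s \<oplus> (r \<oplus> s)"
      using that by (simp add: distr_left)
    \<comment> \<open>Here the sum \<open>r \<oplus> s\<close> is split first, which produces the
      error term; only the second pass splits 2.\<close>
    moreover have "(r \<oplus> s) \<otimes> ?two = r \<oplus> r \<oplus> (s \<oplus> s) \<oplus> ?c r s"
      using that by (simp add: distr_right) (simp add: distr_left)
    ultimately show ?thesis
      using that add_group.m_assoc by simp
  qed
  have **: "?c r s \<in> Im_P" if "r \<in> carrier (add_monoid R)" "s \<in> carrier (add_monoid R)" for r s
    using that by (simp add: act_closed H_closed)
  have ***: "?c r s = \<one>\<^bsub>add_monoid R\<^esub>" if "r \<in> Im_P" "s \<in> carrier (add_monoid R)" for r s
    using that by (auto simp: act_P1 H_closed P_one)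
  show "Im_P \<lhd> add_monoid R" "comm_group (add_monoid R Mod Im_P)"
    using add_group.central_subgroup_quotient[OF subgroup_Im_P, of ?c] * ** *** by blast+
qed

abbreviation (input) cls where "cls r \<equiv> Im_P +> r"

lemma cls_self: "r \<in> carrier R \<Longrightarrow> r \<in> cls r"
  using add_group.rcos_self[OF _ subgroup_Im_P] by (simp add: a_r_coset_def)

lemma cls_memE:
  assumes "s \<in> cls r" "r \<in> carrier R"
  obtains x where "x \<in> carrier E" "s = P x \<oplus> r"
  using assms by (auto simp: a_r_coset_def r_coset_def)

lemma cls_mem_closed: "\<lbrakk>s \<in> cls r; r \<in> carrier R\<rbrakk> \<Longrightarrow> s \<in> carrier R"
  by (auto elim!: cls_memE)

lemma cls_P_add: "\<lbrakk>x \<in> carrier E; r \<in> carrier R\<rbrakk> \<Longrightarrow> cls (P x \<oplus> r) = cls r"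
  using add_group.repr_independence[OF _ _ subgroup_Im_P, of "P x \<oplus> r" r]
  by (auto simp: a_r_coset_def r_coset_def)

lemma cls_add:
  assumes "r \<in> carrier R" "s \<in> carrier R"
  shows "cls r <+>\<^bsub>R\<^esub> cls s = cls (r \<oplus> s)"
  using normal.rcos_sum[OF Im_P_normal] assms by (simp add: a_r_coset_def set_add_def)

text \<open>\<open>Im_P\<close> absorbs products on both sides: \<open>P_act\<close> exhibits
  \<open>P x \<otimes> s\<close> and \<open>?p \<otimes> P y\<close> as values of \<open>P\<close>.
  The error term in \<open>(P x \<oplus> r) \<otimes> s\<close> is zero because its action involves
  \<open>P x\<close>.\<close>

lemma mult_P_cosets:
  assumes "r \<in> carrier R" "s \<in> carrier R" "x \<in> carrier E" "y \<in> carrier E"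
  shows "cls ((P x \<oplus> r) \<otimes> (P y \<oplus> s)) = cls (r \<otimes> s)"
proof -
  let ?p = "P x \<oplus> r"
  have "P x \<otimes> s = P (act \<one> \<one> x s)" "?p \<otimes> P y = P (act ?p ?p y \<one>)"
    using assms P_act[of \<one> s x] P_act[of ?p \<one> y] by simp_all
  moreover have "?p \<otimes> (P y \<oplus> s) = ?p \<otimes> P y \<oplus> ?p \<otimes> s"
    using assms by (simp add: distr_left)
  moreover have "?p \<otimes> s = P x \<otimes> s \<oplus> r \<otimes> s"
    using assms by (simp add: distr_right act_P1 H_closed P_one)
  ultimately show ?thesis
    using assms by (simp add: cls_P_add act_closed)
qed

text \<open>\<open>rcoset_mult\<close> is a union of cosets over all pairs of representatives; by
  \<open>mult_P_cosets\<close> they all coincide, and \<open>cls_self\<close> shows that the union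
  is not empty.\<close>

lemma cls_mult:
  assumes "r \<in> carrier R" "s \<in> carrier R"
  shows "rcoset_mult R Im_P (cls r) (cls s) = cls (r \<otimes> s)"
proof -
  have "cls (r' \<otimes> s') = cls (r \<otimes> s)" if "r' \<in> cls r" "s' \<in> cls s" for r' s'
    using that(1) assms(1)
  proof (rule cls_memE)
    fix x assume x: "x \<in> carrier E" "r' = P x \<oplus> r"
    show ?thesis
      using that(2) assms(2) by (rule cls_memE) (simp add: x mult_P_cosets assms)
  qed
  then show ?thesis
    using cls_self assms unfolding rcoset_mult_def by blast
qed

lemma carrier_quotient: "carrier (R Quot Im_P) = cls ` carrier R"
  by (auto simp: FactRing_def A_RCOSETS_def RCOSETS_def a_r_coset_def)

lemma quotient_simps:
  "add (R Quot Im_P) = set_add R" "monoid.mult (R Quot Im_P) = rcoset_mult R Im_P"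
  "one (R Quot Im_P) = cls \<one>"
  by (simp_all add: FactRing_def)

text \<open>\<open>R\<close> fails to be a ring in two ways, noncommutative addition and a defective
  right distributive law. Both defects lie in \<open>Im_P\<close>.\<close>

lemma ring_quotient: "ring (R Quot Im_P)"
proof (rule ringI)
  have "add_monoid (R Quot Im_P) = add_monoid R Mod Im_P"
    by (simp add: FactRing_def FactGroup_def A_RCOSETS_def set_add_def)
  then show "abelian_group (R Quot Im_P)"
    using Im_P_quotient_comm by (intro comm_group_abelian_groupI) simp
  show "monoid (R Quot Im_P)"
    by unfold_locales (auto simp: carrier_quotient quotient_simps cls_mult mult_monoid.m_assoc)
  fix K L N
  assume "K \<in> carrier (R Quot Im_P)" "L \<in> carrier (R Quot Im_P)" "N \<in> carrier (R Quot Im_P)"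
  then obtain r s t where *: "r \<in> carrier R" "s \<in> carrier R" "t \<in> carrier R"
      "K = cls r" "L = cls s" "N = cls t"
    by (auto simp: carrier_quotient)
  have comm: "cls (x \<oplus> y) = cls (y \<oplus> x)" if "x \<in> carrier R" "y \<in> carrier R" for x y
  proof -
    have "cls x <+>\<^bsub>R\<^esub> cls y = cls y <+>\<^bsub>R\<^esub> cls x"
      using comm_groupE(4)[OF Im_P_quotient_comm, of "cls x" "cls y"] that
      by (auto simp: set_add_def a_r_coset_def carrier_FactGroup)
    then show ?thesis
      using that by (simp add: cls_add)
  qed
  \<comment> \<open>The error term stands on the right; commutativity modulo \<open>Im_P\<close>
    brings it to the front, where \<open>cls_P_add\<close> absorbs it.\<close>
  have "cls ((r \<oplus> s) \<otimes> t) = cls (r \<otimes> t \<oplus> s \<otimes> t)"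
  proof -
    let ?x = "act r s (H t) \<one>"
    have "?x \<in> carrier E" using * by (simp add: act_closed H_closed)
    then have "cls (r \<otimes> t \<oplus> s \<otimes> t \<oplus> P ?x) = cls (P ?x \<oplus> (r \<otimes> t \<oplus> s \<otimes> t))"
      using * comm by simp
    then show ?thesis
      using * \<open>?x \<in> carrier E\<close> by (simp add: cls_P_add distr_right)
  qed
  then show "(K \<oplus>\<^bsub>R Quot Im_P\<^esub> L) \<otimes>\<^bsub>R Quot Im_P\<^esub> N
      = K \<otimes>\<^bsub>R Quot Im_P\<^esub> N \<oplus>\<^bsub>R Quot Im_P\<^esub> L \<otimes>\<^bsub>R Quot Im_P\<^esub> N"
    using * by (simp add: quotient_simps cls_add cls_mult)
  show "N \<otimes>\<^bsub>R Quot Im_P\<^esub> (K \<oplus>\<^bsub>R Quot Im_P\<^esub> L)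
      = N \<otimes>\<^bsub>R Quot Im_P\<^esub> K \<oplus>\<^bsub>R Quot Im_P\<^esub> N \<otimes>\<^bsub>R Quot Im_P\<^esub> L"
    using * by (simp add: quotient_simps cls_add cls_mult distr_left)
qed

text \<open>Additivity in each scalar splits off the summands containing some \<open>P x\<close>,
  and these vanish by \<open>act_P_eq_one\<close>. This is what makes the operadic composition well
  defined on cosets.\<close>

lemma act_cls:
  assumes "r \<in> carrier R" "s \<in> carrier R" "t \<in> carrier R" "x \<in> carrier E"
    and "r' \<in> cls r" "s' \<in> cls s" "t' \<in> cls t"
  shows "act r' s' x t' = act r s x t"
  using assms
  by (auto elim!: cls_memE simp: act_add1 act_add2 act_add4 act_P_eq_one act_closed)

lemma OP_simps:
  "op1 (OP R E act T P) = R Quot Im_P" "op2 (OP R E act T P) = E" "op_swap (OP R E act T P) = T"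
  by (simp_all add: OP_def)

lemma op_comp_cls:
  assumes "r \<in> carrier R" "s \<in> carrier R" "t \<in> carrier R" "x \<in> carrier E"
  shows "op_comp (OP R E act T P) (cls r) (cls s) x (cls t) = act r s x t"
proof -
  have "{act r' s' x t' | r' s' t'. r' \<in> cls r \<and> s' \<in> cls s \<and> t' \<in> cls t} = {act r s x t}"
    using act_cls[OF assms] cls_self assms(1-3) by blast
  then show ?thesis by (simp add: OP_def)
qed

text \<open>On representatives each composition law becomes the square ring axiom of the same
  shape.\<close>

lemma class2_operad_OP: "class2_operad (OP R E act T P)"
  by (intro class2_operad.intro class2_operad_axioms.intro)
    (auto simp: OP_simps T_hom T_T carrier_quotient quotient_simps op_comp_cls cls_add cls_mult
      act_closed act_add1 act_add2 act_add3 act_add4 act_one act_act T_act hom_in_carrier[OF T_hom]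
      ring_quotient ee.comm_group_axioms)

end

section \<open>Centrality of \<open>A\<close> and independence of representatives\<close>

context CP_module
begin

lemma A_closed [simp]: "a \<in> A \<Longrightarrow> a \<in> carrier M"
  using A_subgroup by (rule subgroup.mem_carrier)

lemma A_central: "\<lbrakk>a \<in> A; m \<in> carrier M\<rbrakk> \<Longrightarrow> m \<otimes>\<^bsub>M\<^esub> a = a \<otimes>\<^bsub>M\<^esub> m"
  and A_normal: "A \<lhd> M"
  and A_quotient_comm: "comm_group (M Mod A)"
proof -
  let ?two = "\<one> \<oplus> \<one>"
  have two: "sm m ?two = m \<otimes>\<^bsub>M\<^esub> m" if "m \<in> carrier M" for m
    using that by (simp add: sm_add_right sm_one)
  \<comment> \<open>Acting by 2 is doubling, so \<open>sm_add_left\<close> at 2 compares the double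
    of a sum with the sum of the doubles, up to one bracket.\<close>
  have "m \<otimes>\<^bsub>M\<^esub> n \<otimes>\<^bsub>M\<^esub> m \<otimes>\<^bsub>M\<^esub> n = m \<otimes>\<^bsub>M\<^esub> m \<otimes>\<^bsub>M\<^esub> n \<otimes>\<^bsub>M\<^esub> n \<otimes>\<^bsub>M\<^esub> br m n (H ?two)"
    if "m \<in> carrier M" "n \<in> carrier M" for m n
    using sm_add_left[OF that, of ?two] that by (simp add: two M.m_assoc br_closed H_closed)
  note quotient = M.central_subgroup_quotient[OF A_subgroup, of "\<lambda>m n. br m n (H ?two)", OF this]
  show "\<lbrakk>a \<in> A; m \<in> carrier M\<rbrakk> \<Longrightarrow> m \<otimes>\<^bsub>M\<^esub> a = a \<otimes>\<^bsub>M\<^esub> m"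
    by (rule quotient(1)) (simp_all add: br_in_A H_closed A_br)
  show "A \<lhd> M"
    by (rule quotient(2)) (simp_all add: br_in_A H_closed A_br)
  show "comm_group (M Mod A)"
    by (rule quotient(3)) (simp_all add: br_in_A H_closed A_br)
qed

abbreviation (input) Mcls where "Mcls m \<equiv> A #>\<^bsub>M\<^esub> m"

lemma Mcls_memE:
  assumes "n \<in> Mcls m"
  obtains a where "a \<in> A" "n = a \<otimes>\<^bsub>M\<^esub> m"
  using assms by (auto simp: r_coset_def)

lemma Mcls_mult:
  assumes "m \<in> carrier M" "n \<in> carrier M"
  shows "Mcls m <#>\<^bsub>M\<^esub> Mcls n = Mcls (m \<otimes>\<^bsub>M\<^esub> n)"
  using A_normal assms by (rule normal.rcos_sum)

lemma Mcls_eq_A: "a \<in> A \<Longrightarrow> Mcls a = A"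
  using M.coset_join2[OF _ A_subgroup] by simp

text \<open>The correction in \<open>sm_add_left\<close> appears on the right, while cosets absorb
  \<open>A\<close> on the left; centrality of \<open>A\<close> bridges the two.\<close>

lemma Mcls_A_mult:
  assumes "a \<in> A" "m \<in> carrier M"
  shows "Mcls (a \<otimes>\<^bsub>M\<^esub> m) = Mcls m" and "Mcls (m \<otimes>\<^bsub>M\<^esub> a) = Mcls m"
proof -
  show "Mcls (a \<otimes>\<^bsub>M\<^esub> m) = Mcls m"
    using M.coset_mult_assoc[of A a m] Mcls_eq_A[of a] subgroup.subset[OF A_subgroup] assms by simp
  then show "Mcls (m \<otimes>\<^bsub>M\<^esub> a) = Mcls m"
    using assms by (simp add: A_central)
qed

text \<open>The symmetry \<open>br_T\<close> moves \<open>a\<close> into the first slot, where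
  \<open>A_br\<close> applies.\<close>

lemma br_A: "\<lbrakk>m \<in> carrier M; a \<in> A; x \<in> carrier E\<rbrakk> \<Longrightarrow> br m a x = \<one>\<^bsub>M\<^esub>"
  using br_T[of a m x] A_br[of a m "T x"] hom_in_carrier[OF T_hom] by simp

text \<open>\<open>sm\<close> is additive in its first argument only up to a bracket, but at zero
  this bracket vanishes because zero lies in \<open>A\<close>.\<close>

lemma sm_zero: "r \<in> carrier R \<Longrightarrow> sm \<one>\<^bsub>M\<^esub> r = \<one>\<^bsub>M\<^esub>"
  using sm_add_left[of "\<one>\<^bsub>M\<^esub>" "\<one>\<^bsub>M\<^esub>" r] sm_closed[of "\<one>\<^bsub>M\<^esub>" r]
    A_br[OF subgroup.one_closed[OF A_subgroup], of "\<one>\<^bsub>M\<^esub>" "H r"]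
  by (simp add: H_closed)

lemma br_Mcls:
  assumes "m \<in> carrier M" "n \<in> carrier M" "x \<in> carrier E" "m' \<in> Mcls m" "n' \<in> Mcls n"
  shows "br m' n' x = br m n x"
  using assms by (auto elim!: Mcls_memE simp: br_add1 br_add2 A_br br_A br_closed)

text \<open>Changing \<open>r\<close> by \<open>P x\<close> changes \<open>sm m r\<close> by
  \<open>sm m (P x) = br m m x\<close>. This lies in \<open>A\<close>, so it disappears in the
  quotient by \<open>A\<close>.\<close>

lemma sm_cls:
  assumes "m \<in> carrier M" "r \<in> carrier R" "r' \<in> cls r"
  obtains a where "a \<in> A" "sm m r' = a \<otimes>\<^bsub>M\<^esub> sm m r"
  using assms(3,2)
proof (rule cls_memE)
  fix x assume "x \<in> carrier E" "r' = P x \<oplus> r"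
  then have "sm m r' = br m m x \<otimes>\<^bsub>M\<^esub> sm m r" "br m m x \<in> A"
    using assms by (simp_all add: sm_add_right sm_P br_in_A)
  then show ?thesis by (rule that[rotated])
qed

text \<open>For \<open>a\<close> in \<open>A\<close> the difference \<open>br a a x\<close> is zero,
  so the quotient ring acts on \<open>A\<close> itself and not merely modulo a subgroup.\<close>

lemma sm_A_cls:
  assumes "a \<in> A" "r \<in> carrier R" "r' \<in> cls r"
  shows "sm a r' = sm a r"
  using assms by (auto elim!: cls_memE simp: sm_add_right sm_P A_br sm_closed)

lemma Mcls_sm:
  assumes "m \<in> carrier M" "r \<in> carrier R" "m' \<in> Mcls m" "r' \<in> cls r"
  shows "Mcls (sm m' r') = Mcls (sm m r)"
  using assms(3)
proof (rule Mcls_memE)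
  fix a assume a: "a \<in> A" "m' = a \<otimes>\<^bsub>M\<^esub> m"
  have r': "r' \<in> carrier R" by (rule cls_mem_closed[OF assms(4,2)])
  have "sm m' r' = sm a r' \<otimes>\<^bsub>M\<^esub> sm m r'"
    using a assms r' by (simp add: sm_add_left A_br H_closed sm_closed)
  then have "Mcls (sm m' r') = Mcls (sm m r')"
    using a assms r' by (simp add: Mcls_A_mult A_sm sm_closed)
  \<comment> \<open>The module representative has been replaced; it remains to replace the
    scalar.\<close>
  also have "\<dots> = Mcls (sm m r)"
    using assms(1,2,4)
    by (rule sm_cls) (simp add: Mcls_A_mult assms sm_closed)
  finally show ?thesis .
qed

section \<open>The graded algebra structure\<close>

text \<open>Representatives are picked by \<open>SOME\<close>; \<open>Mcls_sm\<close> and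
  \<open>sm_A_cls\<close> show that the choice does not matter, and \<open>br_Mcls\<close> does the
  same for \<open>bracket\<close>.\<close>

definition scale :: "nat \<Rightarrow> 'm set \<times> 'm \<Rightarrow> 'r set \<Rightarrow> 'm set \<times> 'm"
  where "scale i u K =
    (if i = 1 then (Mcls (sm (SOME m. m \<in> fst u) (SOME r. r \<in> K)), \<one>\<^bsub>M\<^esub>)
     else if i = 2 then (A, sm (snd u) (SOME r. r \<in> K))
     else (A, \<one>\<^bsub>M\<^esub>))"

definition bracket :: "nat \<Rightarrow> nat \<Rightarrow> 'm set \<times> 'm \<Rightarrow> 'm set \<times> 'm \<Rightarrow> 'e \<Rightarrow> 'm set \<times> 'm"
  where "bracket i j u v x =
    (if (i, j) = (1, 1) then (A, br (SOME m. m \<in> fst u) (SOME n. n \<in> fst v) x)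
     else (A, \<one>\<^bsub>M\<^esub>))"

lemma some_cls: "r \<in> carrier R \<Longrightarrow> (SOME r'. r' \<in> cls r) \<in> cls r"
  by (rule someI) (rule cls_self)

lemma some_Mcls: "m \<in> carrier M \<Longrightarrow> (SOME m'. m' \<in> Mcls m) \<in> Mcls m"
  by (rule someI) (rule M.rcos_self[OF _ A_subgroup])

lemma scale_1:
  "\<lbrakk>m \<in> carrier M; r \<in> carrier R\<rbrakk> \<Longrightarrow> scale 1 (Mcls m, \<one>\<^bsub>M\<^esub>) (cls r) = (Mcls (sm m r), \<one>\<^bsub>M\<^esub>)"
  by (simp add: scale_def Mcls_sm some_cls some_Mcls)

lemma scale_2:
  "\<lbrakk>a \<in> A; r \<in> carrier R\<rbrakk> \<Longrightarrow> scale 2 (A, a) (cls r) = (A, sm a r)"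
  by (simp add: scale_def sm_A_cls some_cls)

lemma bracket_1_1:
  "\<lbrakk>m \<in> carrier M; n \<in> carrier M; x \<in> carrier E\<rbrakk>
    \<Longrightarrow> bracket 1 1 (Mcls m, \<one>\<^bsub>M\<^esub>) (Mcls n, \<one>\<^bsub>M\<^esub>) x = (A, br m n x)"
  by (simp add: bracket_def br_Mcls some_Mcls)

lemma bracket_trivial: "(i, j) \<noteq> (1, 1) \<Longrightarrow> bracket i j u v x = (A, \<one>\<^bsub>M\<^esub>)"
  by (auto simp: bracket_def)

lemma one_Gr: "\<one>\<^bsub>Gr M A i\<^esub> = (A, \<one>\<^bsub>M\<^esub>)"
  by (simp add: Gr_def singleton_group_def)

lemma carrier_Gr:
  "carrier (Gr M A i) =
    (if i = 1 then (\<lambda>m. (Mcls m, \<one>\<^bsub>M\<^esub>)) ` carrier M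
     else if i = 2 then Pair A ` A else {(A, \<one>\<^bsub>M\<^esub>)})"
  by (auto simp: Gr_def carrier_FactGroup)

lemma mult_Gr_1:
  "\<lbrakk>m \<in> carrier M; n \<in> carrier M\<rbrakk>
    \<Longrightarrow> (Mcls m, \<one>\<^bsub>M\<^esub>) \<otimes>\<^bsub>Gr M A 1\<^esub> (Mcls n, \<one>\<^bsub>M\<^esub>) = (Mcls (m \<otimes>\<^bsub>M\<^esub> n), \<one>\<^bsub>M\<^esub>)"
  by (simp add: Gr_def singleton_group_def Mcls_mult)

lemma mult_Gr_2: "(A, a) \<otimes>\<^bsub>Gr M A 2\<^esub> (A, b) = (A, a \<otimes>\<^bsub>M\<^esub> b)"
  by (simp add: Gr_def singleton_group_def)

text \<open>Degree 1 is commutative by \<open>A_quotient_comm\<close>. Degree 2 is the group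
  \<open>A\<close>, which is abelian because it is central in \<open>M\<close>.\<close>

lemma comm_group_Gr: "comm_group (Gr M A i)"
proof -
  have "group (Gr M A i)"
    using normal.factorgroup_is_group[OF A_normal] subgroup.subgroup_is_group[OF A_subgroup]
    by (simp add: Gr_def DirProd_group M.is_group)
  then show ?thesis
    using comm_groupE(4)[OF A_quotient_comm] A_central
    by (intro group.group_comm_groupI) (auto simp: Gr_def singleton_group_def split: if_splits)
qed

text \<open>The obstruction to additivity is \<open>br m n (H r)\<close>. In degree 1 it is absorbed
  because it lies in \<open>A\<close>; in degree 2 it vanishes because the arguments lie in
  \<open>A\<close>.\<close>

lemma right_module_Gr:
  assumes "i \<ge> 1" shows "right_module (R Quot Im_P) (Gr M A i) (scale i)"
proof -
  consider "i = 1" | "i = 2" | "i \<noteq> 1" "i \<noteq> 2" by blast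
  then show ?thesis
  proof cases
    case 1
    show ?thesis unfolding 1
      by (intro right_module.intro right_module_axioms.intro ring_quotient comm_group_Gr)
        (auto simp: carrier_Gr carrier_quotient scale_1 mult_Gr_1 quotient_simps cls_add cls_mult
          sm_closed sm_one sm_sm sm_add_left sm_add_right Mcls_A_mult br_in_A H_closed
          simp del: One_nat_def)
  next
    case 2
    show ?thesis unfolding 2
      by (intro right_module.intro right_module_axioms.intro ring_quotient comm_group_Gr)
        (auto simp: carrier_Gr carrier_quotient scale_2 mult_Gr_2 quotient_simps cls_add cls_mult
          sm_closed sm_one sm_sm sm_add_left sm_add_right A_sm A_br H_closed
          subgroup.m_closed[OF A_subgroup])
  next
    case 3
    have "scale i u K = \<one>\<^bsub>Gr M A i\<^esub>" for u K
      using 3 by (simp add: scale_def one_Gr)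
    moreover have "carrier (Gr M A i) = {\<one>\<^bsub>Gr M A i\<^esub>}"
      using 3 by (simp add: carrier_Gr one_Gr)
    ultimately show ?thesis
      using group.is_monoid[OF comm_group.axioms(2)[OF comm_group_Gr]]
      by (intro right_module.intro right_module_axioms.intro ring_quotient comm_group_Gr)
        (simp_all add: monoid.r_one)
  qed
qed

lemma graded_algebra_Gr: "graded_algebra (OP R E act T P) (Gr M A) scale bracket"
proof -
  note monoid_Gr = group.is_monoid[OF comm_group.axioms(2)[OF comm_group_Gr]]
  \<comment> \<open>The same pair is the zero of every degree, so trivial brackets can be handled
    without identifying \<open>i + j\<close>.\<close>
  have one_closed: "(A, \<one>\<^bsub>M\<^esub>) \<in> carrier (Gr M A i)" for i
    using monoid.one_closed[OF monoid_Gr[of i]] by (simp add: one_Gr)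
  have one_one: "(A, \<one>\<^bsub>M\<^esub>) \<otimes>\<^bsub>Gr M A i\<^esub> (A, \<one>\<^bsub>M\<^esub>) = (A, \<one>\<^bsub>M\<^esub>)" for i
    using monoid.r_one[OF monoid_Gr[of i] one_closed[of i]] by (simp add: one_Gr)
  have scale_one: "scale i (A, \<one>\<^bsub>M\<^esub>) K = (A, \<one>\<^bsub>M\<^esub>)"
    if "i \<ge> 2" "K \<in> carrier (R Quot Im_P)" for i K
  proof (cases "i = 2")
    case True
    with that show ?thesis
      by (auto simp: carrier_quotient scale_2 sm_zero subgroup.one_closed[OF A_subgroup])
  qed (use that in \<open>simp add: scale_def\<close>)
  show ?thesis
  proof (intro graded_algebra.intro graded_algebra_axioms.intro class2_operad_OP, unfold OP_simps)
    fix i :: nat assume "i \<ge> 1"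
    then show "right_module (R Quot Im_P) (Gr M A i) (scale i)"
      by (rule right_module_Gr)
  next
    fix i j u v x
    assume *: "u \<in> carrier (Gr M A i)" "v \<in> carrier (Gr M A j)" "x \<in> carrier E"
    show "bracket i j u v x \<in> carrier (Gr M A (i + j))"
    proof (cases "(i, j) = (1, 1)")
      case True
      then show ?thesis
        using * by (auto simp: carrier_Gr bracket_1_1[unfolded One_nat_def] br_in_A)
    qed (simp add: bracket_trivial one_closed)
    show "bracket j i v u x = bracket i j u v (T x)"
    proof (cases "(i, j) = (1, 1)")
      case True
      then show ?thesis
        using * by (auto simp: carrier_Gr bracket_1_1[unfolded One_nat_def] br_T hom_in_carrier[OF T_hom])
    qed (auto simp: bracket_trivial)
  next
    fix i j u u' v x
    assume *: "u \<in> carrier (Gr M A i)" "u' \<in> carrier (Gr M A i)" "v \<in> carrier (Gr M A j)"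
      "x \<in> carrier E"
    show "bracket i j (u \<otimes>\<^bsub>Gr M A i\<^esub> u') v x
        = bracket i j u v x \<otimes>\<^bsub>Gr M A (i + j)\<^esub> bracket i j u' v x"
    proof (cases "(i, j) = (1, 1)")
      case True
      then show ?thesis
        using *
        by (auto simp: carrier_Gr bracket_1_1[unfolded One_nat_def] mult_Gr_1[unfolded One_nat_def]
            mult_Gr_2[unfolded numeral_2_eq_2] br_add1)
    qed (simp add: bracket_trivial one_one)
  next
    fix i j u v v' x
    assume *: "u \<in> carrier (Gr M A i)" "v \<in> carrier (Gr M A j)" "v' \<in> carrier (Gr M A j)"
      "x \<in> carrier E"
    show "bracket i j u (v \<otimes>\<^bsub>Gr M A j\<^esub> v') x
        = bracket i j u v x \<otimes>\<^bsub>Gr M A (i + j)\<^esub> bracket i j u v' x"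
    proof (cases "(i, j) = (1, 1)")
      case True
      then show ?thesis
        using *
        by (auto simp: carrier_Gr bracket_1_1[unfolded One_nat_def] mult_Gr_1[unfolded One_nat_def]
            mult_Gr_2[unfolded numeral_2_eq_2] br_add2)
    qed (simp add: bracket_trivial one_one)
  next
    fix i j u v x x'
    assume *: "u \<in> carrier (Gr M A i)" "v \<in> carrier (Gr M A j)" "x \<in> carrier E" "x' \<in> carrier E"
    show "bracket i j u v (x \<otimes>\<^bsub>E\<^esub> x')
        = bracket i j u v x \<otimes>\<^bsub>Gr M A (i + j)\<^esub> bracket i j u v x'"
    proof (cases "(i, j) = (1, 1)")
      case True
      then show ?thesis
        using *
        by (auto simp: carrier_Gr bracket_1_1[unfolded One_nat_def]
            mult_Gr_2[unfolded numeral_2_eq_2] br_add3)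
    qed (simp add: bracket_trivial one_one)
  next
    fix i j :: nat and u v x K L N
    assume *: "i \<ge> 1" "j \<ge> 1" "u \<in> carrier (Gr M A i)" "v \<in> carrier (Gr M A j)" "x \<in> carrier E"
      "K \<in> carrier (R Quot Im_P)" "L \<in> carrier (R Quot Im_P)" "N \<in> carrier (R Quot Im_P)"
    show "scale (i + j) (bracket i j (scale i u K) (scale j v L) x) N
        = bracket i j u v (op_comp (OP R E act T P) K L x N)"
    proof (cases "(i, j) = (1, 1)")
      \<comment> \<open>The inputs are scaled in degree 1 and the output in degree 2, so on
        representatives the claim is \<open>br_sm\<close>.\<close>
      case True
      then show ?thesis
        using *
        by (auto simp: carrier_Gr carrier_quotient bracket_1_1[unfolded One_nat_def]
            scale_1[unfolded One_nat_def] scale_2[unfolded numeral_2_eq_2] op_comp_cls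
            br_sm br_in_A sm_closed act_closed)
    next
      \<comment> \<open>Both brackets are zero, and \<open>i + j \<ge> 2\<close> lets
        \<open>scale_one\<close> remove the outer scaling.\<close>
      case False
      then show ?thesis
        using * by (simp add: bracket_trivial scale_one)
    qed
  next
    fix i j k :: nat and u v w x y
    assume "i \<ge> 1" "j \<ge> 1"
    then show "bracket (i + j) k (bracket i j u v x) w y = \<one>\<^bsub>Gr M A (i + j + k)\<^esub>"
      by (simp add: bracket_trivial one_Gr)
  qed
qed

end

text \<open>Naturality is expressed by prescribing the operations on representatives. By
  \<open>carrier_Gr\<close> these values determine scaling in degrees 1 and 2 and every bracket, and
  the higher degrees are zero groups.\<close>

theorem proposition2p2p21:
  fixes R :: "'r ring" and E :: "'e monoid"
    and act :: "'r \<Rightarrow> 'r \<Rightarrow> 'e \<Rightarrow> 'r \<Rightarrow> 'e"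
    and T :: "'e \<Rightarrow> 'e" and H :: "'r \<Rightarrow> 'e" and P :: "'e \<Rightarrow> 'r"
    and M :: "'m monoid" and sm :: "'m \<Rightarrow> 'r \<Rightarrow> 'm" and br :: "'m \<Rightarrow> 'm \<Rightarrow> 'e \<Rightarrow> 'm"
    and A :: "'m set"
  assumes "square_ring R E act T H P"
    and "CP_module R E act T H P M sm br A"
  shows "\<exists>sc brk. graded_algebra (OP R E act T P) (Gr M A) sc brk
    \<and> (\<forall>m\<in>carrier M. \<forall>r\<in>carrier R.
          sc 1 (A #>\<^bsub>M\<^esub> m, \<one>\<^bsub>M\<^esub>) ((P ` carrier E) +>\<^bsub>R\<^esub> r) = (A #>\<^bsub>M\<^esub> sm m r, \<one>\<^bsub>M\<^esub>))
    \<and> (\<forall>a\<in>A. \<forall>r\<in>carrier R.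
          sc 2 (A, a) ((P ` carrier E) +>\<^bsub>R\<^esub> r) = (A, sm a r))
    \<and> (\<forall>m\<in>carrier M. \<forall>n\<in>carrier M. \<forall>x\<in>carrier E.
          brk 1 1 (A #>\<^bsub>M\<^esub> m, \<one>\<^bsub>M\<^esub>) (A #>\<^bsub>M\<^esub> n, \<one>\<^bsub>M\<^esub>) x = (A, br m n x))
    \<and> (\<forall>i\<ge>1. \<forall>j\<ge>1. (i, j) \<noteq> (1, 1) \<longrightarrow>
          (\<forall>u\<in>carrier (Gr M A i). \<forall>v\<in>carrier (Gr M A j). \<forall>x\<in>carrier E.
            brk i j u v x = \<one>\<^bsub>Gr M A (i + j)\<^esub>))"
proof -
  interpret CP_module R E act T H P M sm br A by (rule assms(2))
  show ?thesis
    using graded_algebra_Gr scale_1 scale_2 bracket_1_1 bracket_trivial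
    by (intro exI[of _ scale] exI[of _ bracket]) (simp add: one_Gr del: One_nat_def)
qed

end
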